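(* Let $(\Sigma,\sharp)$ be a positive ranked alphabet, and let $A=\langle\mathbb K^m,\{A^x\}_{x\in\Sigma},\odot_A,\alpha\rangle$ and $B=\langle\mathbb K^n,\{B^x\}_{x\in\Sigma},\odot_B,\beta\rangle$ be two HWMs over $(\Sigma,\sharp)$, computing the series $r_A$ and $r_B$. Define the HWM $C=\langle\mathbb K^{m+n},\{C^x\}_{x\in\Sigma},\odot,\tau\rangle$ by: - $C^x_{i_1\dots i_{\sharp x}}=A^x_{i_1\dots i_{\sharp x}}$ if $1\le i_1,\dots,i_{\sharp x}\le m$; $C^x_{i_1\dots i_{\sharp x}}=B^x_{j_1\dots j_{\sharp x}}$ with $j_k=i_k-m$ if $m<i_1,\dots,i_{\sharp x}\le m+n$; and $C^x_{i_1\dots i_{\sharp x}}=0$ otherwise; - $\tau_i=\alpha_i$ if $1\le i\le m$ and $\tau_i=\beta_{i-m}$ otherwise; - $\mathbf e_i\odot\mathbf e_j=\mathbf e_i\odot_A\mathbf e_j$ if $1\le i,j\le m$ (with $\mathbb K^m$ embedded in $\mathbb K^{m+n}$ via $\mathbf e_k\mapsto\mathbf e_k$); $\mathbf e_i\odot\mathbf e_j=t_m(\mathbf e_{i-m}\odot_B\mathbf e_{j-m})$ if $m<i,j\le m+n$; and $\mathbf e_i\odot\mathbf e_j=0$ otherwise; where $t_m:\mathbb K^n\to\mathbb K^{m+n}$ is the linear map with $t_m(\mathbf e_k)=\mathbf e_{k+m}$ for $1\le k\le n$. Then $C$ computes the sum of the two series on connected hypergraphs: $r_C(G)=r_A(G)+r_B(G)$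 for every connected hypergraph $G$ over $(\Sigma,\sharp)$.
   Context: Throughout, $\mathbb K=\mathbb R$ or $\mathbb C$, $[d]=\{1,\dots,d\}$, and $(\mathbf e_1,\dots,\mathbf e_d)$ is the canonical basis of $\mathbb K^d$. A ranked alphabet $(\Sigma,\sharp)$ is a finite set $\Sigma$ with an arity map $\sharp:\Sigma\to\mathbb N$; it is positive if $\sharp x\ge 1$ for all $x\in\Sigma$. A hypergraph $G=(V,E,l)$ over a positive ranked alphabet $(\Sigma,\sharp)$ consists of a non-empty finite set $V$ (vertices), a map $l:V\to\Sigma$, and a partition $E$ (whose non-empty blocks are called hyperedges) of the set of ports $P_G=\{(v,j): v\in V, 1\le j\le \sharp v\}$, where $\sharp v=\sharp l(v)$. $G$ is connected if for every partition $V=V_1\cup V_2$ into two non-empty sets there are a hyperedge $h$ and ports $(v_1,i),(v_2,j)\in h$ with $v_1\in V_1$, $v_2\in V_2$. A product on $\mathbb K^d$ is a bilinear map $\odot:\mathbb K^d\times\mathbb K^d\to\mathbb K^d$ that is associative and symmetric. A rank $d$ ($d\geq1$) Hypergraph Weighted Model (HWM) over $(\Sigma,\sharp)$ is a tuple $M=\langle \mathbb K^d,\{T^x\}_{x\in\Sigma},\odot,\alpha\rangle$ where $\odot$ is a product on $\mathbb K^d$, $\alpha\in\mathbb K^d$, and $T^x\in\bigotimes^{\sharp x}\mathbb K^d$ (viewed as an array $(T^x_{i_1\dots i_{\sharp x}})$) for each $x$. It computes the series $$r_M(G)=\sum_{\gamma:P_G\to[d]}\ \Big(\prod_{v\in V}T^{l(v)}_{\gamma(v,1)\dots\gamma(v,\sharp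 v)}\Big)\prod_{h\in E}\alpha^\top\Big(\bigodot_{p\in h}\mathbf e_{\gamma(p)}\Big)$$ (one factor for each port of $h$). *)

theory Defs
  imports
    "HOL-Library.Disjoint_Sets"
    "HOL-Library.FuncSet"
    "HOL-Algebra.FiniteProduct"
    "Jordan_Normal_Form.Matrix"
begin

text \<open>
  Coordinates of vectors and entries of arrays are indexed from \<open>0\<close>, as usual for
  the type of vectors used here, so \<open>[d]\<close> becomes \<open>{..<d}\<close>; the ports of
  a vertex \<open>v\<close> are numbered from \<open>1\<close> to its arity.
\<close>

definition positive_ranked_alphabet :: "'s set \<Rightarrow> ('s \<Rightarrow> nat) \<Rightarrow> bool" where
  "positive_ranked_alphabet S ar \<longleftrightarrow> finite S \<and> (\<forall>x\<in>S. 1 \<le> ar x)"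

record ('v, 's) hypergraph =
  verts :: "'v set"
  hyperedges :: "('v \<times> nat) set set"
  label :: "'v \<Rightarrow> 's"

definition ports :: "('s \<Rightarrow> nat) \<Rightarrow> ('v, 's) hypergraph \<Rightarrow> ('v \<times> nat) set" where
  "ports ar G = {(v, j). v \<in> verts G \<and> 1 \<le> j \<and> j \<le> ar (label G v)}"

definition is_hypergraph ::
  "'s set \<Rightarrow> ('s \<Rightarrow> nat) \<Rightarrow> ('v, 's) hypergraph \<Rightarrow> bool" where
  "is_hypergraph S ar G \<longleftrightarrow>
     finite (verts G) \<and> verts G \<noteq> {} \<and> label G ` verts G \<subseteq> S \<and>
     partition_on (ports ar G) (hyperedges G)"

definition connected_hypergraph :: "('v, 's) hypergraph \<Rightarrow> bool" where
  "connected_hypergraph G \<longleftrightarrow>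
     (\<forall>V1 V2. V1 \<noteq> {} \<and> V2 \<noteq> {} \<and> V1 \<inter> V2 = {} \<and> V1 \<union> V2 = verts G \<longrightarrow>
        (\<exists>h\<in>hyperedges G. \<exists>v1\<in>V1. \<exists>v2\<in>V2. \<exists>i j. (v1, i) \<in> h \<and> (v2, j) \<in> h))"

definition bilinear_on :: "nat \<Rightarrow> ('k::field vec \<Rightarrow> 'k vec \<Rightarrow> 'k vec) \<Rightarrow> bool" where
  "bilinear_on d f \<longleftrightarrow>
     (\<forall>u\<in>carrier_vec d. \<forall>v\<in>carrier_vec d. f u v \<in> carrier_vec d) \<and>
     (\<forall>u\<in>carrier_vec d. \<forall>v\<in>carrier_vec d. \<forall>w\<in>carrier_vec d.
        f (u + v) w = f u w + f v w \<and> f w (u + v) = f w u + f w v) \<and>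
     (\<forall>c. \<forall>u\<in>carrier_vec d. \<forall>v\<in>carrier_vec d.
        f (c \<cdot>\<^sub>v u) v = c \<cdot>\<^sub>v f u v \<and> f u (c \<cdot>\<^sub>v v) = c \<cdot>\<^sub>v f u v)"

definition is_product :: "nat \<Rightarrow> ('k::field vec \<Rightarrow> 'k vec \<Rightarrow> 'k vec) \<Rightarrow> bool" where
  "is_product d f \<longleftrightarrow> bilinear_on d f \<and>
     (\<forall>u\<in>carrier_vec d. \<forall>v\<in>carrier_vec d. \<forall>w\<in>carrier_vec d. f (f u v) w = f u (f v w)) \<and>
     (\<forall>u\<in>carrier_vec d. \<forall>v\<in>carrier_vec d. f u v = f v u)"

text \<open>
  An order \<open>k\<close> tensor over a \<open>d\<close>-dimensional space is an array, given as a function on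
  index lists that is \<open>0\<close> by convention on lists that are not valid multi-indices.
\<close>

definition tensors :: "nat \<Rightarrow> nat \<Rightarrow> (nat list \<Rightarrow> 'k::field) set" where
  "tensors d k = {T. \<forall>is. \<not> (length is = k \<and> set is \<subseteq> {..<d}) \<longrightarrow> T is = 0}"

record ('s, 'k) hwm =
  hdim :: nat
  tensor :: "'s \<Rightarrow> nat list \<Rightarrow> 'k"
  vmult :: "'k vec \<Rightarrow> 'k vec \<Rightarrow> 'k vec"
  final :: "'k vec"

definition is_hwm :: "'s set \<Rightarrow> ('s \<Rightarrow> nat) \<Rightarrow> ('s, 'k::field) hwm \<Rightarrow> bool" where
  "is_hwm S ar M \<longleftrightarrow>
     1 \<le> hdim M \<and>
     (\<forall>x\<in>S. tensor M x \<in> tensors (hdim M) (ar x)) \<and>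
     is_product (hdim M) (vmult M) \<and>
     final M \<in> carrier_vec (hdim M)"

text \<open>
  A product need not have a unit.  Iterated products over non-empty finite sets are
  taken in the commutative monoid obtained by adjoining a formal unit \<open>None\<close>.
\<close>

definition unital_hull :: "nat \<Rightarrow> ('k vec \<Rightarrow> 'k vec \<Rightarrow> 'k vec) \<Rightarrow> 'k vec option monoid" where
  "unital_hull d f =
     \<lparr>carrier = insert None (Some ` carrier_vec d),
      mult = (\<lambda>a b. case a of None \<Rightarrow> b
                | Some u \<Rightarrow> (case b of None \<Rightarrow> a | Some v \<Rightarrow> Some (f u v))),
      one = None\<rparr>"

definition vprod ::
  "nat \<Rightarrow> ('k vec \<Rightarrow> 'k vec \<Rightarrow> 'k vec) \<Rightarrow> ('p \<Rightarrow> 'k vec) \<Rightarrow> 'p set \<Rightarrow> 'k vec" where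
  "vprod d f g h = the (finprod (unital_hull d f) (\<lambda>p. Some (g p)) h)"

lemma comm_monoid_unital_hull:
  assumes "is_product d f"
  shows "comm_monoid (unital_hull d f)"
  using assms
  by unfold_locales (auto simp: unital_hull_def is_product_def bilinear_on_def Units_def)

lemma vprod_singleton_insert:
  assumes "is_product d f"
  shows "g p \<in> carrier_vec d \<Longrightarrow> vprod d f g {p} = g p"
    and "\<lbrakk>finite h; h \<noteq> {}; p \<notin> h; g ` insert p h \<subseteq> carrier_vec d\<rbrakk> \<Longrightarrow>
      vprod d f g (insert p h) = f (g p) (vprod d f g h)"
proof -
  let ?H = "unital_hull d f"
  interpret comm_monoid ?H by (rule comm_monoid_unital_hull) fact
  have car: "Some u \<in> carrier ?H \<longleftrightarrow> u \<in> carrier_vec d" for u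
    by (auto simp: unital_hull_def)
  have mult: "Some u \<otimes>\<^bsub>?H\<^esub> Some v = Some (f u v)" for u v
    by (simp add: unital_hull_def)
  have closed: "f u v \<in> carrier_vec d" if "u \<in> carrier_vec d" "v \<in> carrier_vec d" for u v
    using assms that by (simp add: is_product_def bilinear_on_def)
  show "vprod d f g {p} = g p" if "g p \<in> carrier_vec d" for p
    using that by (simp add: vprod_def car)
  have ex: "\<exists>w\<in>carrier_vec d. finprod ?H (\<lambda>p. Some (g p)) h = Some w"
    if "finite h" "h \<noteq> {}" "g ` h \<subseteq> carrier_vec d" for h
    using that
  proof (induction h rule: finite_ne_induct)
    case (singleton p)
    then show ?case by (simp add: car)
  next
    case (insert p h)
    then obtain w where "w \<in> carrier_vec d" "finprod ?H (\<lambda>p. Some (g p)) h = Some w"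
      by auto
    moreover have "(\<lambda>p. Some (g p)) \<in> h \<rightarrow> carrier ?H" using insert.prems car by auto
    ultimately show ?case using insert by (simp add: car mult closed)
  qed
  show "vprod d f g (insert p h) = f (g p) (vprod d f g h)"
    if h: "finite h" "h \<noteq> {}" "p \<notin> h" "g ` insert p h \<subseteq> carrier_vec d"
  proof -
    obtain w where "finprod ?H (\<lambda>p. Some (g p)) h = Some w" using ex[of h] h by auto
    moreover have "(\<lambda>p. Some (g p)) \<in> h \<rightarrow> carrier ?H" using h car by auto
    ultimately show ?thesis using h by (simp add: vprod_def car mult)
  qed
qed

definition series ::
  "('s \<Rightarrow> nat) \<Rightarrow> ('s, 'k::field) hwm \<Rightarrow> ('v, 's) hypergraph \<Rightarrow> 'k" where
  "series ar M G =
     (\<Sum>\<gamma>\<in>ports ar G \<rightarrow>\<^sub>E {..<hdim M}.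
        (\<Prod>v\<in>verts G.
           tensor M (label G v) (map (\<lambda>j. \<gamma> (v, j)) [1..<Suc (ar (label G v))])) *
        (\<Prod>h\<in>hyperedges G.
           final M \<bullet> vprod (hdim M) (vmult M) (\<lambda>p. unit_vec (hdim M) (\<gamma> p)) h))"

text \<open>
  The bilinear map with prescribed values \<open>b i j\<close> on pairs of basis vectors.
\<close>

definition bilinear_extension ::
  "nat \<Rightarrow> (nat \<Rightarrow> nat \<Rightarrow> 'k::field vec) \<Rightarrow> 'k vec \<Rightarrow> 'k vec \<Rightarrow> 'k vec" where
  "bilinear_extension d b u v =
     vec d (\<lambda>k. \<Sum>i<d. \<Sum>j<d. u $ i * v $ j * b i j $ k)"

lemma bilinear_on_bilinear_extension: "bilinear_on d (bilinear_extension d b)"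
  by (auto simp: bilinear_on_def bilinear_extension_def sum.distrib sum_distrib_left
      algebra_simps intro!: eq_vecI)

lemma bilinear_extension_unit_vec:
  assumes "i < d" "j < d" "b i j \<in> carrier_vec d"
  shows "bilinear_extension d b (unit_vec d i) (unit_vec d j) = b i j"
proof (rule eq_vecI)
  show "dim_vec (bilinear_extension d b (unit_vec d i) (unit_vec d j)) = dim_vec (b i j)"
    using assms by (simp add: bilinear_extension_def)
  fix k assume "k < dim_vec (b i j)"
  then have "k < d" using assms by simp
  have "(\<Sum>i'<d. \<Sum>j'<d. unit_vec d i $ i' * unit_vec d j $ j' * b i' j' $ k) =
        (\<Sum>i'<d. if i' = i then (\<Sum>j'<d. if j' = j then b i' j' $ k else 0) else 0)"
    using assms by (intro sum.cong refl) (auto simp: if_distrib[of "\<lambda>c. c * _"] cong: if_cong)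
  also have "\<dots> = b i j $ k" using assms by simp
  finally show "bilinear_extension d b (unit_vec d i) (unit_vec d j) $ k = b i j $ k"
    using \<open>k < d\<close> by (simp add: bilinear_extension_def)
qed

text \<open>
  The vectors \<open>u @\<^sub>v 0\<^sub>v n\<close> and \<open>0\<^sub>v m @\<^sub>v w\<close> are the images of
  \<open>u\<close> and \<open>w\<close> under the embeddings as the first \<open>m\<close> and the last \<open>n\<close> coordinates.
\<close>

definition hwm_sum :: "('s, 'k::field) hwm \<Rightarrow> ('s, 'k) hwm \<Rightarrow> ('s, 'k) hwm" where
  "hwm_sum A B = (let m = hdim A; n = hdim B in
     \<lparr>hdim = m + n,
      tensor = (\<lambda>x is.
        if set is \<subseteq> {..<m} then tensor A x is
        else if set is \<subseteq> {m..<m + n} then tensor B x (map (\<lambda>i. i - m) is)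
        else 0),
      vmult = bilinear_extension (m + n) (\<lambda>i j.
        if i < m \<and> j < m then vmult A (unit_vec m i) (unit_vec m j) @\<^sub>v 0\<^sub>v n
        else if m \<le> i \<and> m \<le> j then 0\<^sub>v m @\<^sub>v vmult B (unit_vec n (i - m)) (unit_vec n (j - m))
        else 0\<^sub>v (m + n)),
      final = vec (m + n) (\<lambda>i. if i < m then final A $ i else final B $ (i - m))\<rparr>)"

end

theory Submission
  imports Defs
begin

text \<open>
  Writing \<open>K\<^sup>m\<^sup>+\<^sup>n\<close> as \<open>K\<^sup>m \<times> K\<^sup>n\<close>, the product of the sum model is the componentwise one, so a
  product in which basis vectors of both blocks occur is \<open>0\<close>.  An assignment contributes to the
  series only if all ports of each vertex, and all ports of each hyperedge, carry indices of the
  same block; on a connected hypergraph such an assignment takes all its values in one block,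
  and the two kinds of assignments give the two summands.
\<close>

section \<open>Coordinates of linear and bilinear maps\<close>

lemma sum_lessThan_add:
  fixes g :: "nat \<Rightarrow> 'a::comm_monoid_add"
  shows "(\<Sum>i<m + n. g i) = (\<Sum>i<m. g i) + (\<Sum>i<n. g (m + i))"
  by (induction n) (simp_all add: add.assoc)

text \<open>Linearity is assumed on \<open>carrier_vec d\<close> alone, because the vector type
  contains vectors of all dimensions. The proof builds \<open>u\<close> up one coordinate at a
  time.\<close>

lemma linear_expansion:
  fixes g :: "'k::field vec \<Rightarrow> 'k vec"
  assumes closed: "\<And>u. u \<in> carrier_vec d \<Longrightarrow> g u \<in> carrier_vec d"
    and add: "\<And>u v. u \<in> carrier_vec d \<Longrightarrow> v \<in> carrier_vec d \<Longrightarrow> g (u + v) = g u + g v"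
    and smult: "\<And>c u. u \<in> carrier_vec d \<Longrightarrow> g (c \<cdot>\<^sub>v u) = c \<cdot>\<^sub>v g u"
    and u: "u \<in> carrier_vec d" and k: "k < d"
  shows "g u $ k = (\<Sum>i<d. u $ i * g (unit_vec d i) $ k)"
proof -
  \<comment> \<open>The truncation \<open>tr n\<close> keeps the first \<open>n\<close> coordinates
    of \<open>u\<close>, so it runs from the zero vector to \<open>u\<close>, and each step adds one
    multiple of a basis vector.\<close>
  define tr where "tr = (\<lambda>n. vec d (\<lambda>i. if i < n then u $ i else 0))"
  have tr: "tr n \<in> carrier_vec d" for n by (simp add: tr_def)
  have ind: "n \<le> d \<Longrightarrow> g (tr n) $ k = (\<Sum>i<n. u $ i * g (unit_vec d i) $ k)" for n
  proof (induction n)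
    case 0
    \<comment> \<open>That \<open>g\<close> vanishes at the zero vector follows from homogeneity
      with scalar \<open>0\<close>.\<close>
    have "tr 0 = 0 \<cdot>\<^sub>v tr 0" by (auto simp: tr_def)
    then have "g (tr 0) = 0 \<cdot>\<^sub>v g (tr 0)" using smult[OF tr] by metis
    then have "g (tr 0) $ k = 0 * g (tr 0) $ k"
      using closed[OF tr[of 0]] k by (metis carrier_vecD index_smult_vec(1))
    then show ?case by simp
  next
    case (Suc n)
    have "tr (Suc n) = tr n + u $ n \<cdot>\<^sub>v unit_vec d n"
      using Suc.prems by (intro eq_vecI) (auto simp: tr_def less_Suc_eq)
    then have "g (tr (Suc n)) = g (tr n) + u $ n \<cdot>\<^sub>v g (unit_vec d n)"
      by (simp add: add smult tr)
    then show ?case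
      using Suc k closed[OF tr[of n]] closed[OF unit_vec_carrier[of d n]] by simp
  qed
  have "tr d = u" using u by (intro eq_vecI) (auto simp: tr_def)
  with ind[of d] show ?thesis by simp
qed

text \<open>Linear expansion in one argument after the other. It makes the given products comparable
  with the product of the sum model, which is defined through basis vectors.\<close>

lemma bilinear_on_expansion:
  assumes f: "bilinear_on d f" and u: "u \<in> carrier_vec d" and v: "v \<in> carrier_vec d"
    and k: "k < d"
  shows "f u v $ k = (\<Sum>i<d. \<Sum>j<d. u $ i * v $ j * f (unit_vec d i) (unit_vec d j) $ k)"
proof -
  have "f u v $ k = (\<Sum>i<d. u $ i * f (unit_vec d i) v $ k)"
    by (rule linear_expansion[where g = "\<lambda>u. f u v"]) (use f u v k in \<open>auto simp: bilinear_on_def\<close>)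
  also have "\<dots> = (\<Sum>i<d. u $ i * (\<Sum>j<d. v $ j * f (unit_vec d i) (unit_vec d j) $ k))"
    by (intro sum.cong refl arg_cong2[of _ _ _ _ "(*)"] linear_expansion)
      (use f u v k in \<open>auto simp: bilinear_on_def\<close>)
  finally show ?thesis by (simp add: sum_distrib_left mult.assoc)
qed

lemma bilinear_on_closed:
  "bilinear_on d f \<Longrightarrow> u \<in> carrier_vec d \<Longrightarrow> v \<in> carrier_vec d \<Longrightarrow> f u v \<in> carrier_vec d"
  by (simp add: bilinear_on_def)

lemma bilinear_on_zero:
  fixes f :: "'k::field vec \<Rightarrow> 'k vec \<Rightarrow> 'k vec"
  assumes "bilinear_on d f" and "v \<in> carrier_vec d"
  shows "f (0\<^sub>v d) v = 0\<^sub>v d" and "f v (0\<^sub>v d) = 0\<^sub>v d"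
proof -
  have "f (0 \<cdot>\<^sub>v 0\<^sub>v d) v = 0 \<cdot>\<^sub>v f (0\<^sub>v d) v" "f v (0 \<cdot>\<^sub>v 0\<^sub>v d) = 0 \<cdot>\<^sub>v f v (0\<^sub>v d)"
    using assms by (simp_all add: bilinear_on_def)
  moreover have "f (0\<^sub>v d) v \<in> carrier_vec d" "f v (0\<^sub>v d) \<in> carrier_vec d"
    by (rule bilinear_on_closed[OF assms(1)]; use assms(2) in simp)+
  moreover have "0 \<cdot>\<^sub>v w = 0\<^sub>v d" if "w \<in> carrier_vec d" for w :: "'k vec"
    using that by auto
  ultimately show "f (0\<^sub>v d) v = 0\<^sub>v d" "f v (0\<^sub>v d) = 0\<^sub>v d" by simp_all
qed

lemma carrier_vec_addE:
  assumes "u \<in> carrier_vec (m + n)"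
  obtains u1 u2 where "u1 \<in> carrier_vec m" "u2 \<in> carrier_vec n" "u = u1 @\<^sub>v u2"
  using assms vec_first_last_append[of u m n] vec_first_carrier vec_last_carrier by metis

section \<open>Iterated products over non-empty finite sets\<close>

lemma vprod_carrier:
  assumes f: "is_product d f" and "finite h" "h \<noteq> {}" "g ` h \<subseteq> carrier_vec d"
  shows "vprod d f g h \<in> carrier_vec d"
  using assms(2-)
proof (induction h rule: finite_ne_induct)
  case (singleton p)
  then show ?case using f by (simp add: vprod_singleton_insert(1))
next
  case (insert p h)
  have "bilinear_on d f" using f by (simp add: is_product_def)
  then have "f (g p) (vprod d f g h) \<in> carrier_vec d"
    by (rule bilinear_on_closed) (use insert in auto)
  then show ?case using vprod_singleton_insert(2)[OF f insert.hyps(1-3) insert.prems] by simp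
qed

text \<open>Serves to exchange unit vectors for expressions with a case distinction on the block,
  which agree with them only on the ports of the hyperedge in question.\<close>

lemma vprod_cong:
  assumes f: "is_product d f" and "finite h" "h \<noteq> {}" "g ` h \<subseteq> carrier_vec d"
    and "\<And>p. p \<in> h \<Longrightarrow> g p = g' p"
  shows "vprod d f g h = vprod d f g' h"
  using assms(2-)
proof (induction h rule: finite_ne_induct)
  case (singleton p)
  then have "g p = g' p" "g p \<in> carrier_vec d" by auto
  then show ?case using f vprod_singleton_insert(1)[OF f, of g p] vprod_singleton_insert(1)[OF f, of g' p]
    by simp
next
  case (insert p h)
  have "g' ` insert p h = g ` insert p h"
    using insert.prems(2) by (intro image_cong) auto
  then have "g' ` insert p h \<subseteq> carrier_vec d" using insert.prems(1) by simp
  then show ?case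
    using insert vprod_singleton_insert(2)[OF f insert.hyps(1-3) insert.prems(1)]
      vprod_singleton_insert(2)[OF f insert.hyps(1-3), of g'] by simp
qed

text \<open>The order of the factors is irrelevant, so the zero factor can be split off first;
  bilinearity then annihilates the rest. A singleton is treated apart, since there is no product
  over the empty set to multiply with.\<close>

lemma vprod_zero:
  assumes f: "is_product d f" and h: "finite h" "g ` h \<subseteq> carrier_vec d"
    and p: "p \<in> h" "g p = 0\<^sub>v d"
  shows "vprod d f g h = 0\<^sub>v d"
proof (cases "h = {p}")
  case True
  then show ?thesis using f p by (simp add: vprod_singleton_insert)
next
  case False
  let ?h = "h - {p}"
  have ne: "?h \<noteq> {}" using False p by auto
  have "vprod d f g (insert p ?h) = f (g p) (vprod d f g ?h)"
    using f h p ne by (intro vprod_singleton_insert) auto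
  moreover have "vprod d f g ?h \<in> carrier_vec d"
    using f h p ne by (intro vprod_carrier) auto
  moreover have "bilinear_on d f" using f by (simp add: is_product_def)
  ultimately show ?thesis using p by (simp add: bilinear_on_zero insert_absorb)
qed

lemma unit_vec_add:
  shows "i < m \<Longrightarrow> unit_vec (m + n) i = unit_vec m i @\<^sub>v 0\<^sub>v n"
    and "i < n \<Longrightarrow> unit_vec (m + n) (m + i) = 0\<^sub>v m @\<^sub>v unit_vec n i"
  by (auto intro!: eq_vecI simp: unit_vec_def append_vec_def)

section \<open>The sum model and its componentwise product\<close>

locale hwm_pair =
  fixes S :: "'s set" and ar :: "'s \<Rightarrow> nat" and A B :: "('s, 'k::field) hwm"
  assumes alphabet: "positive_ranked_alphabet S ar"
    and A: "is_hwm S ar A" and B: "is_hwm S ar B"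
begin

abbreviation "m \<equiv> hdim A"
abbreviation "n \<equiv> hdim B"
abbreviation "C \<equiv> hwm_sum A B"

lemma hdim_C: "hdim C = m + n"
  by (simp add: hwm_sum_def Let_def)

lemma product_A: "is_product m (vmult A)" and product_B: "is_product n (vmult B)"
  using A B by (simp_all add: is_hwm_def)

lemmas bilinear_A = product_A[unfolded is_product_def, THEN conjunct1]
lemmas bilinear_B = product_B[unfolded is_product_def, THEN conjunct1]

lemma closed_A: "u \<in> carrier_vec m \<Longrightarrow> v \<in> carrier_vec m \<Longrightarrow> vmult A u v \<in> carrier_vec m"
  and closed_B: "u \<in> carrier_vec n \<Longrightarrow> v \<in> carrier_vec n \<Longrightarrow> vmult B u v \<in> carrier_vec n"
  by (fact bilinear_on_closed[OF bilinear_A] bilinear_on_closed[OF bilinear_B])+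

text \<open>This identifies the product of the sum model, given on basis vectors, with that of the
  direct product of the two algebras. All later facts about \<open>vmult C\<close> go through
  it.\<close>

lemma vmult_append:
  assumes u: "u1 \<in> carrier_vec m" "u2 \<in> carrier_vec n"
    and v: "v1 \<in> carrier_vec m" "v2 \<in> carrier_vec n"
  shows "vmult C (u1 @\<^sub>v u2) (v1 @\<^sub>v v2) = vmult A u1 v1 @\<^sub>v vmult B u2 v2" (is "?l = ?r")
proof (rule eq_vecI)
  have dA: "dim_vec (vmult A (unit_vec m i) (unit_vec m j)) = m" for i j
    using closed_A by (metis carrier_vecD unit_vec_carrier)
  have dB: "dim_vec (vmult B (unit_vec n i) (unit_vec n j)) = n" for i j
    using closed_B by (metis carrier_vecD unit_vec_carrier)
  have dims: "dim_vec (vmult A u1 v1) = m" "dim_vec (vmult B u2 v2) = n"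
    using closed_A closed_B u v by auto
  show "dim_vec ?l = dim_vec ?r"
    using dims by (simp add: hwm_sum_def Let_def bilinear_extension_def)
  fix k assume "k < dim_vec ?r"
  then have k: "k < m + n" using dims by simp
  let ?b = "\<lambda>i j. if i < m \<and> j < m then vmult A (unit_vec m i) (unit_vec m j) @\<^sub>v 0\<^sub>v n
        else if m \<le> i \<and> m \<le> j then 0\<^sub>v m @\<^sub>v vmult B (unit_vec n (i - m)) (unit_vec n (j - m))
        else 0\<^sub>v (m + n)"
  have "?l $ k = (\<Sum>i<m + n. \<Sum>j<m + n. (u1 @\<^sub>v u2) $ i * (v1 @\<^sub>v v2) $ j * ?b i j $ k)"
    using k by (simp add: hwm_sum_def Let_def bilinear_extension_def)
  \<comment> \<open>Of the four blocks of the double sum only the two diagonal ones survive, as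
    \<open>?b\<close> is the zero vector off the diagonal.\<close>
  also have "\<dots> =
      (\<Sum>i<m. \<Sum>j<m. u1 $ i * v1 $ j * (vmult A (unit_vec m i) (unit_vec m j) @\<^sub>v 0\<^sub>v n) $ k)
      + (\<Sum>i<n. \<Sum>j<n. u2 $ i * v2 $ j * (0\<^sub>v m @\<^sub>v vmult B (unit_vec n i) (unit_vec n j)) $ k)"
    using u v k by (simp add: sum_lessThan_add)
  \<comment> \<open>A coordinate below \<open>m\<close> sees only zeros in the second sum, any other
    coordinate only zeros in the first; the remaining sum is the expansion of one given
    product.\<close>
  also have "\<dots> = ?r $ k"
  proof (cases "k < m")
    case True
    then show ?thesis
      using bilinear_on_expansion[OF bilinear_A u(1) v(1)] by (simp add: dA dB dims)
  next
    case False
    then have "k - m < n" using k by auto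
    with False show ?thesis
      using bilinear_on_expansion[OF bilinear_B u(2) v(2)] k by (simp add: dA dB dims)
  qed
  finally show "?l $ k = ?r $ k" .
qed

text \<open>Bilinearity is built into \<open>bilinear_extension\<close>; associativity and symmetry
  hold in each component once vectors are split into their two parts.\<close>

lemma product_C: "is_product (m + n) (vmult C)"
proof -
  have bil: "bilinear_on (m + n) (vmult C)"
    by (simp add: hwm_sum_def Let_def bilinear_on_bilinear_extension)
  have "vmult C (vmult C u v) w = vmult C u (vmult C v w)"
    if "u \<in> carrier_vec (m + n)" "v \<in> carrier_vec (m + n)" "w \<in> carrier_vec (m + n)" for u v w
  proof -
    have "vmult A (vmult A x y) z = vmult A x (vmult A y z)"
      if "x \<in> carrier_vec m" "y \<in> carrier_vec m" "z \<in> carrier_vec m" for x y z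
      using product_A that by (simp add: is_product_def)
    moreover have "vmult B (vmult B x y) z = vmult B x (vmult B y z)"
      if "x \<in> carrier_vec n" "y \<in> carrier_vec n" "z \<in> carrier_vec n" for x y z
      using product_B that by (simp add: is_product_def)
    ultimately show ?thesis
      using that
      by (elim carrier_vec_addE) (simp add: vmult_append closed_A closed_B)
  qed
  moreover have "vmult C u v = vmult C v u"
    if "u \<in> carrier_vec (m + n)" "v \<in> carrier_vec (m + n)" for u v
  proof -
    have "vmult A x y = vmult A y x" if "x \<in> carrier_vec m" "y \<in> carrier_vec m" for x y
      using product_A that by (simp add: is_product_def)
    moreover have "vmult B x y = vmult B y x" if "x \<in> carrier_vec n" "y \<in> carrier_vec n" for x y
      using product_B that by (simp add: is_product_def)
    ultimately show ?thesis
      using that by (elim carrier_vec_addE) (metis vmult_append)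
  qed
  ultimately show ?thesis using bil by (simp add: is_product_def)
qed

lemma final_C: "final C = final A @\<^sub>v final B"
  using A B by (auto simp: hwm_sum_def Let_def is_hwm_def intro!: eq_vecI)

lemma final_carrier: "final A \<in> carrier_vec m" "final B \<in> carrier_vec n"
  using A B by (simp_all add: is_hwm_def)

lemma tensor_C_A: "set is \<subseteq> {..<m} \<Longrightarrow> tensor C x is = tensor A x is"
  by (simp add: hwm_sum_def Let_def)

text \<open>The empty list has to be excluded: it passes the test for the first block vacuously and
  would be evaluated by the tensor of \<open>A\<close>.\<close>

lemma tensor_C_B:
  assumes "is \<noteq> []" "set is \<subseteq> {..<n}"
  shows "tensor C x (map ((+) m) is) = tensor B x is"
proof -
  have "\<not> set (map ((+) m) is) \<subseteq> {..<m}"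
    using assms(1) by (cases "is") auto
  moreover have "set (map ((+) m) is) \<subseteq> {m..<m + n}"
    using assms(2) by auto
  ultimately show ?thesis
    by (simp add: hwm_sum_def Let_def comp_def)
qed

lemma tensor_C_mixed:
  "\<not> set is \<subseteq> {..<m} \<Longrightarrow> \<not> set is \<subseteq> {m..<m + n} \<Longrightarrow> tensor C x is = 0"
  by (simp add: hwm_sum_def Let_def)

text \<open>For the tensors, a list inside one block has indices in range, so it can only be invalid
  by its length; then the entry of \<open>A\<close> or \<open>B\<close> is already
  \<open>0\<close>.\<close>

lemma is_hwm_C: "is_hwm S ar C"
proof -
  have "tensor C x is = 0"
    if x: "x \<in> S" and bad: "\<not> (length is = ar x \<and> set is \<subseteq> {..<m + n})" for x "is"
  proof -
    have "tensor A x is = 0" if "set is \<subseteq> {..<m}"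
    proof -
      have "set is \<subseteq> {..<m + n}" using that by force
      then have "length is \<noteq> ar x" using bad by simp
      then show ?thesis using A x by (simp add: is_hwm_def tensors_def)
    qed
    moreover have "tensor B x (map (\<lambda>i. i - m) is) = 0" if "set is \<subseteq> {m..<m + n}"
    proof -
      have "set is \<subseteq> {..<m + n}" using that by force
      then have "length is \<noteq> ar x" using bad by simp
      then show ?thesis using B x by (simp add: is_hwm_def tensors_def)
    qed
    ultimately show ?thesis by (simp add: hwm_sum_def Let_def)
  qed
  then have "\<forall>x\<in>S. tensor C x \<in> tensors (m + n) (ar x)" by (auto simp: tensors_def)
  then show ?thesis
    using A product_C final_carrier by (simp add: is_hwm_def hdim_C final_C)
qed

text \<open>Induction from singletons, since the products need not have units; each step is
  \<open>vmult_append\<close>.\<close>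

lemma vprod_append:
  assumes "finite h" "h \<noteq> {}" "a ` h \<subseteq> carrier_vec m" "b ` h \<subseteq> carrier_vec n"
  shows "vprod (m + n) (vmult C) (\<lambda>p. a p @\<^sub>v b p) h =
    vprod m (vmult A) a h @\<^sub>v vprod n (vmult B) b h"
  using assms
proof (induction h rule: finite_ne_induct)
  case (singleton p)
  then show ?case
    by (simp add: vprod_singleton_insert product_A product_B product_C)
next
  case (insert p h)
  have "(\<lambda>p. a p @\<^sub>v b p) ` insert p h \<subseteq> carrier_vec (m + n)"
    using insert.prems by (auto simp: image_subset_iff)
  then have "vprod (m + n) (vmult C) (\<lambda>p. a p @\<^sub>v b p) (insert p h) =
      vmult C (a p @\<^sub>v b p) (vprod (m + n) (vmult C) (\<lambda>p. a p @\<^sub>v b p) h)"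
    by (rule vprod_singleton_insert(2)[OF product_C insert.hyps(1-3)])
  moreover have "vprod m (vmult A) a (insert p h) = vmult A (a p) (vprod m (vmult A) a h)"
    by (rule vprod_singleton_insert(2)[OF product_A insert.hyps(1-3) insert.prems(1)])
  moreover have "vprod n (vmult B) b (insert p h) = vmult B (b p) (vprod n (vmult B) b h)"
    by (rule vprod_singleton_insert(2)[OF product_B insert.hyps(1-3) insert.prems(2)])
  moreover have "vprod m (vmult A) a h \<in> carrier_vec m" "vprod n (vmult B) b h \<in> carrier_vec n"
    using insert by (auto intro!: vprod_carrier product_A product_B)
  ultimately show ?case
    using insert by (simp add: vmult_append)
qed

section \<open>Factors of single hyperedges\<close>

abbreviation weight :: "('s, 'k) hwm \<Rightarrow> ('p \<Rightarrow> nat) \<Rightarrow> 'p set \<Rightarrow> 'k" where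
  "weight M \<gamma> h \<equiv> final M \<bullet> vprod (hdim M) (vmult M) (\<lambda>p. unit_vec (hdim M) (\<gamma> p)) h"

text \<open>A basis vector of the sum space is a basis vector in one component and zero in the
  other, so the product splits by \<open>vprod_append\<close> and the scalar product splits
  accordingly.\<close>

lemma weight_C_split:
  assumes h: "finite h" "h \<noteq> {}" and \<gamma>: "\<gamma> ` h \<subseteq> {..<m + n}"
  shows "weight C \<gamma> h =
    final A \<bullet> vprod m (vmult A) (\<lambda>p. if \<gamma> p < m then unit_vec m (\<gamma> p) else 0\<^sub>v m) h +
    final B \<bullet> vprod n (vmult B) (\<lambda>p. if \<gamma> p < m then 0\<^sub>v n else unit_vec n (\<gamma> p - m)) h"
    (is "_ = final A \<bullet> vprod m (vmult A) ?a h + final B \<bullet> vprod n (vmult B) ?b h")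
proof -
  have e: "unit_vec (m + n) (\<gamma> p) = ?a p @\<^sub>v ?b p" if "p \<in> h" for p
  proof (cases "\<gamma> p < m")
    case False
    then have "\<gamma> p - m < n" "m + (\<gamma> p - m) = \<gamma> p" using \<gamma> that by force+
    then show ?thesis using False unit_vec_add(2)[of "\<gamma> p - m" n m] by simp
  qed (simp add: unit_vec_add)
  have ab: "?a ` h \<subseteq> carrier_vec m" "?b ` h \<subseteq> carrier_vec n" by auto
  have "vprod (m + n) (vmult C) (\<lambda>p. unit_vec (m + n) (\<gamma> p)) h =
      vprod (m + n) (vmult C) (\<lambda>p. ?a p @\<^sub>v ?b p) h"
    by (rule vprod_cong) (use product_C h e in auto)
  also have "\<dots> = vprod m (vmult A) ?a h @\<^sub>v vprod n (vmult B) ?b h"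
    using h ab by (rule vprod_append)
  moreover have "vprod m (vmult A) ?a h \<in> carrier_vec m" "vprod n (vmult B) ?b h \<in> carrier_vec n"
    using vprod_carrier[OF product_A h ab(1)] vprod_carrier[OF product_B h ab(2)] by simp_all
  ultimately show ?thesis
    using final_carrier by (simp add: hdim_C final_C scalar_prod_append)
qed

text \<open>Since \<open>h\<close> has a port, the component in the second block has a zero factor
  and its summand vanishes.\<close>

lemma weight_C_A:
  assumes h: "finite h" "h \<noteq> {}" and \<gamma>: "\<gamma> ` h \<subseteq> {..<m}"
  shows "weight C \<gamma> h = weight A \<gamma> h"
proof -
  let ?a = "\<lambda>p. if \<gamma> p < m then unit_vec m (\<gamma> p) else 0\<^sub>v m"
  let ?b = "\<lambda>p. if \<gamma> p < m then 0\<^sub>v n else unit_vec n (\<gamma> p - m)"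
  obtain p where p: "p \<in> h" using h by auto
  have "vprod n (vmult B) ?b h = 0\<^sub>v n"
    by (rule vprod_zero[OF product_B h(1) _ p]) (use \<gamma> p in auto)
  moreover have "vprod m (vmult A) ?a h = vprod m (vmult A) (\<lambda>p. unit_vec m (\<gamma> p)) h"
    by (rule vprod_cong[OF product_A h]) (use \<gamma> in auto)
  moreover have "\<gamma> ` h \<subseteq> {..<m + n}" using \<gamma> by fastforce
  ultimately show ?thesis using final_carrier weight_C_split[OF h] by simp
qed

text \<open>The shift relates \<open>\<delta>\<close> and \<open>\<gamma>\<close> only on
  \<open>h\<close>, which leaves room for a \<open>\<delta>\<close> that is restricted to the
  ports.\<close>

lemma weight_C_B:
  assumes h: "finite h" "h \<noteq> {}" and \<gamma>: "\<gamma> ` h \<subseteq> {..<n}"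
    and \<delta>: "\<And>p. p \<in> h \<Longrightarrow> \<delta> p = m + \<gamma> p"
  shows "weight C \<delta> h = weight B \<gamma> h"
proof -
  let ?a = "\<lambda>p. if \<delta> p < m then unit_vec m (\<delta> p) else 0\<^sub>v m"
  let ?b = "\<lambda>p. if \<delta> p < m then 0\<^sub>v n else unit_vec n (\<delta> p - m)"
  obtain p where p: "p \<in> h" using h by auto
  have "vprod m (vmult A) ?a h = 0\<^sub>v m"
    by (rule vprod_zero[OF product_A h(1) _ p]) (use \<delta> p in auto)
  moreover have "vprod n (vmult B) ?b h = vprod n (vmult B) (\<lambda>p. unit_vec n (\<gamma> p)) h"
    by (rule vprod_cong[OF product_B h]) (use \<delta> in auto)
  moreover have "\<delta> ` h \<subseteq> {..<m + n}" using \<gamma> \<delta> by fastforce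
  ultimately show ?thesis using final_carrier weight_C_split[OF h] by simp
qed

text \<open>The port \<open>q\<close> puts a zero factor into the first component and
  \<open>p\<close> puts one into the second.\<close>

lemma weight_C_mixed:
  assumes h: "finite h" and \<gamma>: "\<gamma> ` h \<subseteq> {..<m + n}"
    and p: "p \<in> h" "\<gamma> p < m" and q: "q \<in> h" "m \<le> \<gamma> q"
  shows "weight C \<gamma> h = 0"
proof -
  let ?a = "\<lambda>p. if \<gamma> p < m then unit_vec m (\<gamma> p) else 0\<^sub>v m"
  let ?b = "\<lambda>p. if \<gamma> p < m then 0\<^sub>v n else unit_vec n (\<gamma> p - m)"
  have "vprod m (vmult A) ?a h = 0\<^sub>v m"
    by (rule vprod_zero[OF product_A h _ q(1)]) (use q in auto)
  moreover have "vprod n (vmult B) ?b h = 0\<^sub>v n"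
    by (rule vprod_zero[OF product_B h _ p(1)]) (use p in auto)
  moreover have "h \<noteq> {}" using p by auto
  ultimately show ?thesis using final_carrier weight_C_split[OF h _ \<gamma>] by simp
qed

section \<open>Contributions of assignments on a fixed hypergraph\<close>

context
  fixes G :: "('v, 's) hypergraph"
  assumes G: "is_hypergraph S ar G"
begin

abbreviation indices :: "('v \<times> nat \<Rightarrow> nat) \<Rightarrow> 'v \<Rightarrow> nat list" where
  "indices \<gamma> v \<equiv> map (\<lambda>j. \<gamma> (v, j)) [1..<Suc (ar (label G v))]"

abbreviation contribution :: "('s, 'k) hwm \<Rightarrow> ('v \<times> nat \<Rightarrow> nat) \<Rightarrow> 'k" where
  "contribution M \<gamma> \<equiv>
    (\<Prod>v\<in>verts G. tensor M (label G v) (indices \<gamma> v)) * (\<Prod>h\<in>hyperedges G. weight M \<gamma> h)"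

lemma arity_pos: "v \<in> verts G \<Longrightarrow> 1 \<le> ar (label G v)"
  using G alphabet by (auto simp: is_hypergraph_def positive_ranked_alphabet_def)

lemma port: "v \<in> verts G \<Longrightarrow> 1 \<le> j \<Longrightarrow> j \<le> ar (label G v) \<Longrightarrow> (v, j) \<in> ports ar G"
  by (simp add: ports_def)

lemma indices_subset: "\<gamma> \<in> ports ar G \<rightarrow> X \<Longrightarrow> v \<in> verts G \<Longrightarrow> set (indices \<gamma> v) \<subseteq> X"
  by (auto simp: Pi_iff ports_def less_Suc_eq_le simp del: upt_Suc)

text \<open>Ensures that no assignment lies in both blocks at once; with no ports the empty
  assignment would be counted for both models.\<close>

lemma ports_nonempty: "ports ar G \<noteq> {}"
  using G port arity_pos by (force simp: is_hypergraph_def)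

lemma finite_verts: "finite (verts G)"
  using G by (simp add: is_hypergraph_def)

lemma finite_ports: "finite (ports ar G)"
proof -
  have "ports ar G = (SIGMA v:verts G. {1..ar (label G v)})" by (auto simp: ports_def)
  then show ?thesis using finite_verts by simp
qed

lemma hyperedge:
  assumes "h \<in> hyperedges G"
  shows "h \<subseteq> ports ar G" "h \<noteq> {}" "finite h"
proof -
  have part: "partition_on (ports ar G) (hyperedges G)"
    using G by (simp add: is_hypergraph_def)
  show sub: "h \<subseteq> ports ar G" "h \<noteq> {}" using part assms by (auto simp: partition_on_def)
  show "finite h" using sub(1) finite_ports by (rule finite_subset)
qed

lemma finite_hyperedges: "finite (hyperedges G)"
proof (rule finite_subset)
  show "hyperedges G \<subseteq> Pow (ports ar G)" using hyperedge(1) by auto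
  show "finite (Pow (ports ar G))" using finite_ports by simp
qed

lemma contribution_C_A:
  assumes \<gamma>: "\<gamma> \<in> ports ar G \<rightarrow> {..<m}"
  shows "contribution C \<gamma> = contribution A \<gamma>"
proof -
  have "tensor C (label G v) (indices \<gamma> v) = tensor A (label G v) (indices \<gamma> v)"
    if "v \<in> verts G" for v
    using indices_subset[OF \<gamma> that] by (rule tensor_C_A)
  moreover have "weight C \<gamma> h = weight A \<gamma> h" if "h \<in> hyperedges G" for h
    by (rule weight_C_A) (use \<gamma> hyperedge[OF that] in auto)
  ultimately show ?thesis by (simp cong: prod.cong del: upt_Suc)
qed

lemma contribution_C_B:
  assumes \<gamma>: "\<gamma> \<in> ports ar G \<rightarrow> {..<n}"
    and \<delta>: "\<And>p. p \<in> ports ar G \<Longrightarrow> \<delta> p = m + \<gamma> p"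
  shows "contribution C \<delta> = contribution B \<gamma>"
proof -
  have "tensor C (label G v) (indices \<delta> v) = tensor B (label G v) (indices \<gamma> v)"
    if "v \<in> verts G" for v
  proof -
    have "indices \<delta> v = map ((+) m) (indices \<gamma> v)"
      using \<delta> port[OF that] by (simp add: less_Suc_eq_le del: upt_Suc)
    \<comment> \<open>Positivity of the alphabet enters here, to rule out the empty index
      list.\<close>
    moreover have "indices \<gamma> v \<noteq> []" using arity_pos[OF that] by simp
    moreover have "set (indices \<gamma> v) \<subseteq> {..<n}" using indices_subset[OF \<gamma> that] .
    ultimately show ?thesis using tensor_C_B by metis
  qed
  moreover have "weight C \<delta> h = weight B \<gamma> h" if "h \<in> hyperedges G" for h
    by (rule weight_C_B) (use \<gamma> \<delta> hyperedge[OF that] in auto)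
  ultimately show ?thesis by (simp cong: prod.cong del: upt_Suc)
qed

text \<open>If the contribution were non-zero, every vertex would belong to one block. Both blocks
  occur, so connectedness yields a hyperedge joining them, and its factor is
  \<open>0\<close>.\<close>

lemma contribution_C_mixed:
  assumes conn: "connected_hypergraph G" and \<gamma>: "\<gamma> \<in> ports ar G \<rightarrow> {..<m + n}"
    and notA: "\<gamma> \<notin> ports ar G \<rightarrow> {..<m}" and notB: "\<gamma> \<notin> ports ar G \<rightarrow> {m..<m + n}"
  shows "contribution C \<gamma> = 0"
proof (rule ccontr)
  assume nz: "contribution C \<gamma> \<noteq> 0"
  have homogeneous: "set (indices \<gamma> v) \<subseteq> {..<m} \<or> set (indices \<gamma> v) \<subseteq> {m..<m + n}"
    if "v \<in> verts G" for v
  proof -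
    have "tensor C (label G v) (indices \<gamma> v) \<noteq> 0"
      using nz that by (simp add: prod_zero_iff[OF finite_verts] del: upt_Suc)
    then show ?thesis using tensor_C_mixed by blast
  qed
  have mem: "\<gamma> (v, j) \<in> set (indices \<gamma> v)" if "(v, j) \<in> ports ar G" for v j
    using that by (auto simp: ports_def less_Suc_eq_le simp del: upt_Suc)
  define V1 where "V1 = {v \<in> verts G. set (indices \<gamma> v) \<subseteq> {..<m}}"
  \<comment> \<open>As a complement, \<open>V2\<close> gives a partition for free; that its vertices
    lie in the second block comes from \<open>homogeneous\<close>.\<close>
  define V2 where "V2 = verts G - V1"
  have V1: "\<gamma> (v, j) < m" if "v \<in> V1" "(v, j) \<in> ports ar G" for v j
    using that(1) mem[OF that(2)] unfolding V1_def by blast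
  have V2: "m \<le> \<gamma> (v, j)" if "v \<in> V2" "(v, j) \<in> ports ar G" for v j
  proof -
    have "set (indices \<gamma> v) \<subseteq> {m..<m + n}"
      using that(1) homogeneous unfolding V1_def V2_def by blast
    then have "\<gamma> (v, j) \<in> {m..<m + n}" using mem[OF that(2)] by (rule subsetD)
    then show ?thesis by simp
  qed
  have verts: "v \<in> V1 \<or> v \<in> V2" if "(v, j) \<in> ports ar G" for v j
    using that by (auto simp: ports_def V2_def)
  have "V1 \<noteq> {}"
  proof
    assume "V1 = {}"
    then have "\<gamma> \<in> ports ar G \<rightarrow> {m..<m + n}"
      using V2 verts \<gamma> by (fastforce simp: Pi_iff)
    with notB show False ..
  qed
  moreover have "V2 \<noteq> {}"
  proof
    assume "V2 = {}"
    then have "\<gamma> \<in> ports ar G \<rightarrow> {..<m}"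
      using V1 verts by (fastforce simp: Pi_iff)
    with notA show False ..
  qed
  moreover have "V1 \<inter> V2 = {}" "V1 \<union> V2 = verts G" by (auto simp: V1_def V2_def)
  ultimately have "\<exists>h\<in>hyperedges G. \<exists>v1\<in>V1. \<exists>v2\<in>V2. \<exists>i j. (v1, i) \<in> h \<and> (v2, j) \<in> h"
    using conn[unfolded connected_hypergraph_def, rule_format, of V1 V2] by simp
  then obtain h v1 v2 i j
    where h: "h \<in> hyperedges G" "v1 \<in> V1" "v2 \<in> V2" "(v1, i) \<in> h" "(v2, j) \<in> h"
    by blast
  have "weight C \<gamma> h = 0"
    by (rule weight_C_mixed[of _ _ "(v1, i)" "(v2, j)"])
      (use h hyperedge[OF h(1)] V1[of v1 i] V2[of v2 j] \<gamma> in auto)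
  then have "(\<Prod>h\<in>hyperedges G. weight C \<gamma> h) = 0"
    by (intro prod_zero finite_hyperedges bexI[OF _ h(1)])
  with nz show False by simp
qed

lemma series_C:
  assumes conn: "connected_hypergraph G"
  shows "series ar C G = series ar A G + series ar B G"
proof -
  let ?P = "ports ar G"
  let ?shift = "\<lambda>\<gamma>. restrict (\<lambda>p. m + \<gamma> p) ?P"
  let ?FA = "?P \<rightarrow>\<^sub>E {..<m}" and ?FB = "?P \<rightarrow>\<^sub>E {m..<m + n}" and ?FC = "?P \<rightarrow>\<^sub>E {..<m + n}"
  \<comment> \<open>At any port the two kinds of assignments have different values, and a port
    exists.\<close>
  have disj: "?FA \<inter> ?FB = {}"
    using ports_nonempty by (fastforce simp: PiE_iff)
  have sub: "?FA \<union> ?FB \<subseteq> ?FC" by (fastforce simp: PiE_iff)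
  have fin: "finite ?FA" "finite ?FB" "finite ?FC"
    using finite_ports by (simp_all add: finite_PiE)
  have bij: "bij_betw ?shift (?P \<rightarrow>\<^sub>E {..<n}) ?FB"
  \<comment> \<open>Truncated subtraction inverts the shift because values in \<open>?FB\<close> are
    at least \<open>m\<close>. Both maps are restricted to the ports to stay within extensional
    functions.\<close>
  proof (rule bij_betw_byWitness[where f' = "\<lambda>\<delta>. restrict (\<lambda>p. \<delta> p - m) ?P"])
    show "\<forall>\<gamma>\<in>?P \<rightarrow>\<^sub>E {..<n}. restrict (\<lambda>p. ?shift \<gamma> p - m) ?P = \<gamma>"
      by (auto simp: fun_eq_iff PiE_iff extensional_def)
    show "\<forall>\<delta>\<in>?FB. ?shift (restrict (\<lambda>p. \<delta> p - m) ?P) = \<delta>"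
      by (auto simp: fun_eq_iff PiE_iff extensional_def)
    show "?shift ` (?P \<rightarrow>\<^sub>E {..<n}) \<subseteq> ?FB"
      by (auto simp: PiE_iff)
    show "(\<lambda>\<delta>. restrict (\<lambda>p. \<delta> p - m) ?P) ` ?FB \<subseteq> ?P \<rightarrow>\<^sub>E {..<n}"
      by (force simp: PiE_iff)
  qed
  have "series ar C G = (\<Sum>\<gamma>\<in>?FC. contribution C \<gamma>)"
    by (simp add: series_def hdim_C)
  \<comment> \<open>The discarded assignments take values in both blocks; only here is connectedness
    used.\<close>
  also have "\<dots> = (\<Sum>\<gamma>\<in>?FA \<union> ?FB. contribution C \<gamma>)"
  proof (rule sum.mono_neutral_right[OF fin(3) sub], rule ballI)
    fix \<gamma> assume "\<gamma> \<in> ?FC - (?FA \<union> ?FB)"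
    then show "contribution C \<gamma> = 0"
      by (intro contribution_C_mixed conn) (auto simp: PiE_def)
  qed
  also have "\<dots> = (\<Sum>\<gamma>\<in>?FA. contribution C \<gamma>) + (\<Sum>\<gamma>\<in>?FB. contribution C \<gamma>)"
    using fin disj by (intro sum.union_disjoint)
  also have "(\<Sum>\<gamma>\<in>?FA. contribution C \<gamma>) = series ar A G"
    unfolding series_def by (intro sum.cong refl contribution_C_A) auto
  also have "(\<Sum>\<gamma>\<in>?FB. contribution C \<gamma>) =
      (\<Sum>\<gamma>\<in>?P \<rightarrow>\<^sub>E {..<n}. contribution C (?shift \<gamma>))"
    using bij by (rule sum.reindex_bij_betw[symmetric])
  also have "\<dots> = series ar B G"
    unfolding series_def by (intro sum.cong refl contribution_C_B) auto
  finally show ?thesis .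
qed

end

end

text \<open>Both \<open>real\<close> and \<open>complex\<close> are instances of the class
  \<open>real_normed_field\<close>.\<close>

theorem proposition4:
  fixes S :: "'s set" and ar :: "'s \<Rightarrow> nat"
    and A B :: "('s, 'k::real_normed_field) hwm"
  assumes "positive_ranked_alphabet S ar"
    and "is_hwm S ar A" and "is_hwm S ar B"
  shows "is_hwm S ar (hwm_sum A B) \<and>
    (\<forall>G :: ('v, 's) hypergraph. is_hypergraph S ar G \<and> connected_hypergraph G \<longrightarrow>
       series ar (hwm_sum A B) G = series ar A G + series ar B G)"
proof -
  interpret hwm_pair S ar A B by unfold_locales fact+
  show ?thesis using is_hwm_C series_C by blast
qed

end
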